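(* Let $Z=m_{11}P_{11}+m_{12}P_{12}+m_{21}P_{21}$ be a set of fat points in $\mathbb{P}^1\times\mathbb{P}^1$ with $m_{11},m_{12},m_{21}\ge 0$ integers and $m_{12}\ge m_{21}$. If $m_{11}\le m_{21}$, then for all $(a,b)\in\mathbb{N}^2$ $$\Delta H_Z(a,b)=\begin{cases}1 & \text{if } a+b<m_{12}+m_{21},\\ 1-\beta_{0,(a,b)}(Z) & \text{if } a+b=m_{12}+m_{21},\\ 0 & \text{if } a+b>m_{12}+m_{21}.\end{cases}$$
   Context: $k$ is an infinite field of characteristic $0$, and $R=k[x_0,x_1,x_2,x_3]$ is the coordinate ring of $\mathbb{P}^1\times\mathbb{P}^1$, bigraded by $\deg x_0=\deg x_1=(1,0)$, $\deg x_2=\deg x_3=(0,1)$. $\mathbb{N}=\{0,1,2,\dots\}$. Fat points: let $H_1,H_2$ be two non-proportional nonzero forms of degree $(1,0)$ and $V_1,V_2$ two non-proportional nonzero forms of degree $(0,1)$. $P_{ij}$ is the point with bihomogeneous ideal $I_{P_{ij}}=(H_i,V_j)$. For $Z=m_{11}P_{11}+m_{12}P_{12}+m_{21}P_{21}$ put $I_Z=I_{P_{11}}^{m_{11}}\cap I_{P_{12}}^{m_{12}}\cap I_{P_{21}}^{m_{21}}$ (with $I^0=R$). $\beta_{0,(a,b)}(Z)$ denotes the number of elements of bidegree $(a,b)$ in a minimal set of bihomogeneous generators of $I_Z$. Hilbert function: $H_Z(a,b)=\dim_k(R/I_Z)_{(a,b)}$ (equal to $0$ if $a<0$ or $b<0$),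 and its first difference is $\Delta H_Z(a,b)=H_Z(a,b)+H_Z(a-1,b-1)-H_Z(a-1,b)-H_Z(a,b-1)$. *)

theory Defs
  imports
    "HOL-Library.Poly_Mapping"
    "HOL-Library.Numeral_Type"
    "HOL-Algebra.Algebraic_Closure_Type"
    "HOL-Algebra.Ideal_Product"
    "HOL-Algebra.QuotRing"
    "HOL-Algebra.Embedded_Algebras"
begin

text \<open>
  The elements \<open>0, 1, 2, 3\<close> of the numeral type \<open>4\<close> index the variables
  \<open>x\<^sub>0, x\<^sub>1, x\<^sub>2, x\<^sub>3\<close>; a monomial is its exponent vector, and a polynomial is its finitely
  supported family of coefficients, multiplied by convolution.
\<close>

type_synonym 'k bipoly = "(4 \<Rightarrow>\<^sub>0 nat) \<Rightarrow>\<^sub>0 'k"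

abbreviation coord_ring :: "('k::field_char_0) bipoly ring" (\<open>\<R>\<close>)
  where "coord_ring \<equiv> ring_of_type_algebra"

definition scalar :: "'k::field_char_0 \<Rightarrow> 'k bipoly"
  where "scalar c = Poly_Mapping.single 0 c"

text \<open>The whole homogeneous component of bidegree \<open>(a, b)\<close>, including \<open>0\<close>.\<close>

definition bihom :: "nat \<Rightarrow> nat \<Rightarrow> ('k::field_char_0) bipoly set"
  where "bihom a b =
    {f. \<forall>m \<in> Poly_Mapping.keys f.
          Poly_Mapping.lookup m 0 + Poly_Mapping.lookup m 1 = a \<and>
          Poly_Mapping.lookup m 2 + Poly_Mapping.lookup m 3 = b}"

definition proportional :: "('k::field_char_0) bipoly \<Rightarrow> 'k bipoly \<Rightarrow> bool"
  where "proportional f g \<longleftrightarrow> (\<exists>c. f = scalar c * g \<or> g = scalar c * f)"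

definition point_ideal :: "('k::field_char_0) bipoly \<Rightarrow> 'k bipoly \<Rightarrow> 'k bipoly set"
  where "point_ideal h v = Idl\<^bsub>\<R>\<^esub> {h, v}"

text \<open>
  The multiplication of \<^const>\<open>ideals_set\<close> is the product of ideals and its unit is the whole
  ring, so exponent \<open>0\<close> gives the whole ring.
\<close>

definition fat_points_ideal ::
    "('k::field_char_0) bipoly \<Rightarrow> 'k bipoly \<Rightarrow> 'k bipoly \<Rightarrow> 'k bipoly
      \<Rightarrow> nat \<Rightarrow> nat \<Rightarrow> nat \<Rightarrow> 'k bipoly set"
  where "fat_points_ideal H1 H2 V1 V2 m11 m12 m21 =
      point_ideal H1 V1 [^]\<^bsub>ideals_set \<R>\<^esub> m11
    \<inter> point_ideal H1 V2 [^]\<^bsub>ideals_set \<R>\<^esub> m12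
    \<inter> point_ideal H2 V1 [^]\<^bsub>ideals_set \<R>\<^esub> m21"

text \<open>
  Minimality is with respect to inclusion; it excludes the zero polynomial from \<open>G\<close>, so that
  every element of \<open>G\<close> has exactly one bidegree.
\<close>

definition min_bihom_gens :: "('k::field_char_0) bipoly set \<Rightarrow> 'k bipoly set \<Rightarrow> bool"
  where "min_bihom_gens I G \<longleftrightarrow>
    G \<subseteq> (\<Union>a b. bihom a b) \<and> Idl\<^bsub>\<R>\<^esub> G = I \<and> (\<forall>G'. G' \<subset> G \<longrightarrow> Idl\<^bsub>\<R>\<^esub> G' \<noteq> I)"

text \<open>
  For a bihomogeneous ideal the number is the same for every minimal set of bihomogeneous
  generators (graded Nakayama), which is what the definite description relies on.
\<close>

definition betti0 :: "('k::field_char_0) bipoly set \<Rightarrow> nat \<Rightarrow> nat \<Rightarrow> nat"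
  where "betti0 I a b = (THE n. \<exists>G. min_bihom_gens I G \<and> card (G \<inter> bihom a b) = n)"

text \<open>
  \<open>(R/I)\<^bsub>(a,b)\<^esub>\<close> is the image of the component \<open>R\<^bsub>(a,b)\<^esub>\<close> in \<open>R/I\<close>, and the base field acts
  through its image in \<open>R/I\<close>. In the degenerate case \<open>I = R\<close> the latter image is \<open>{0}\<close>, which
  is not a subfield, but \<^const>\<open>ring.dim\<close> still assigns \<open>{0}\<close> the dimension \<open>0\<close>.
\<close>

definition hilbert_fun :: "('k::field_char_0) bipoly set \<Rightarrow> int \<Rightarrow> int \<Rightarrow> int"
  where "hilbert_fun I a b =
    (if a < 0 \<or> b < 0 then 0
     else int ((ring.dim (\<R> Quot I) over range (\<lambda>c. I +>\<^bsub>\<R>\<^esub> scalar c))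
                 ((\<lambda>f. I +>\<^bsub>\<R>\<^esub> f) ` bihom (nat a) (nat b))))"

definition delta_hilbert_fun :: "('k::field_char_0) bipoly set \<Rightarrow> int \<Rightarrow> int \<Rightarrow> int"
  where "delta_hilbert_fun I a b =
    hilbert_fun I a b + hilbert_fun I (a - 1) (b - 1)
      - hilbert_fun I (a - 1) b - hilbert_fun I a (b - 1)"

end

theory Submission
  imports Defs
begin

text \<open>
  After a linear change of coordinates, \<open>H\<^sub>1, H\<^sub>2, V\<^sub>1, V\<^sub>2\<close> are the variables, and the ideal is
  spanned by the monomials \<open>x\<^sub>0\<^sup>i x\<^sub>1\<^sup>j x\<^sub>2\<^sup>k x\<^sub>3\<^sup>l\<close> with \<open>i + k \<ge> m\<^sub>1\<^sub>1\<close>, \<open>i + l \<ge> m\<^sub>1\<^sub>2\<close> and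
  \<open>j + k \<ge> m\<^sub>2\<^sub>1\<close>. The Hilbert function counts the remaining monomials, and inclusion-exclusion
  over multiplication by \<open>x\<^sub>1\<close> and \<open>x\<^sub>3\<close> shows that \<open>\<Delta>H\<close> is one minus the number of monomials
  of the ideal that are divisible within the ideal by neither \<open>x\<^sub>1\<close> nor \<open>x\<^sub>3\<close>. Adding the last two
  inequalities, every monomial of the ideal has total degree at least \<open>d = m\<^sub>1\<^sub>2 + m\<^sub>2\<^sub>1\<close>. In total
  degree \<open>d\<close> all monomials of the ideal are of this kind, and as the ideal starts there they also
  count the generators; above \<open>d\<close>, the assumption \<open>m\<^sub>1\<^sub>1 \<le> m\<^sub>2\<^sub>1 \<le> m\<^sub>1\<^sub>2\<close> leaves exactly one.
\<close>

section \<open>Polynomials in four variables\<close>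

abbreviation keys :: "('a \<Rightarrow>\<^sub>0 'b::zero) \<Rightarrow> 'a set"
  where "keys \<equiv> Poly_Mapping.keys"

abbreviation lookup :: "('a \<Rightarrow>\<^sub>0 'b::zero) \<Rightarrow> 'a \<Rightarrow> 'b"
  where "lookup \<equiv> Poly_Mapping.lookup"

abbreviation single :: "'a \<Rightarrow> 'b::zero \<Rightarrow> 'a \<Rightarrow>\<^sub>0 'b"
  where "single \<equiv> Poly_Mapping.single"

lemma UNIV_4: "(UNIV :: 4 set) = {0, 1, 2, 3}"
proof -
  have "card {0, 1, 2, 3 :: 4} = card (UNIV :: 4 set)"
    by simp
  then show ?thesis
    by (metis card_subset_eq finite_class.finite_UNIV subset_UNIV)
qed

lemma distinct_4 [simp]:
  "(0::4) \<noteq> 1" "(0::4) \<noteq> 2" "(0::4) \<noteq> 3" "(1::4) \<noteq> 2" "(1::4) \<noteq> 3" "(2::4) \<noteq> 3"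
  "(1::4) \<noteq> 0" "(2::4) \<noteq> 0" "(3::4) \<noteq> 0" "(2::4) \<noteq> 1" "(3::4) \<noteq> 1" "(3::4) \<noteq> 2"
  by simp_all

lemma monomial_eqI:
  fixes m n :: "4 \<Rightarrow>\<^sub>0 nat"
  assumes "lookup m 0 = lookup n 0" "lookup m 1 = lookup n 1"
    "lookup m 2 = lookup n 2" "lookup m 3 = lookup n 3"
  shows "m = n"
proof (rule poly_mapping_eqI)
  fix i :: 4
  have "i \<in> {0, 1, 2, 3}"
    using UNIV_4 by blast
  with assms show "lookup m i = lookup n i"
    by auto
qed

section \<open>The coordinate ring, its monomials and its scalars\<close>

lemma ring_of_type_algebra_simps [simp]:
  "carrier ring_of_type_algebra = (UNIV :: 'a::ring_1 set)"
  "\<one>\<^bsub>ring_of_type_algebra\<^esub> = (1 :: 'a)"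
  "\<zero>\<^bsub>ring_of_type_algebra\<^esub> = (0 :: 'a)"
  "x \<otimes>\<^bsub>ring_of_type_algebra\<^esub> y = x * (y :: 'a)"
  "x \<oplus>\<^bsub>ring_of_type_algebra\<^esub> y = x + (y :: 'a)"
  by (simp_all add: ring_of_type_algebra_def)

lemma poly_mapping_eq_sum:
  fixes p :: "'a \<Rightarrow>\<^sub>0 'b::comm_monoid_add"
  shows "p = (\<Sum>m\<in>keys p. single m (lookup p m))"
  by (rule poly_mapping_eqI)
    (auto simp: lookup_sum lookup_single when_def in_keys_iff sum.delta)

text \<open>Reduces additive claims to monomials; the set \<open>S\<close> keeps the induction
  inside a chosen monomial span or bidegree.\<close>

lemma keys_induct [consumes 1, case_names zero add single]:
  fixes p :: "'a \<Rightarrow>\<^sub>0 'b::comm_monoid_add"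
  assumes "keys p \<subseteq> S"
    and "P 0" and "\<And>p q. P p \<Longrightarrow> P q \<Longrightarrow> P (p + q)"
    and "\<And>m c. m \<in> S \<Longrightarrow> P (single m c)"
  shows "P p"
proof -
  have "P (\<Sum>m\<in>A. single m (lookup p m))" if "finite A" "A \<subseteq> S" for A
    using that by (induction A) (auto simp: assms)
  then show ?thesis
    using poly_mapping_eq_sum[of p] assms(1) by (metis finite_keys)
qed

lemma scalar_add: "scalar (c + d) = scalar c + scalar d"
  by (simp add: scalar_def single_add)

lemma scalar_mult: "scalar (c * d) = scalar c * scalar d"
  by (simp add: scalar_def mult_single)

lemma scalar_0 [simp]: "scalar 0 = 0"
  by (simp add: scalar_def)

lemma scalar_1 [simp]: "scalar 1 = 1"
  by (simp add: scalar_def)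

lemma scalar_mult_single: "scalar c * single m d = single m (c * d)"
  by (simp add: scalar_def mult_single)

lemma lookup_scalar_mult [simp]: "lookup (scalar c * p) m = c * lookup p m"
  unfolding scalar_def mult_map_scale_conv_mult[symmetric]
  by (simp add: Poly_Mapping.map.rep_eq when_def)

lemma keys_scalar_mult: "keys (scalar c * p) \<subseteq> keys p"
  by (auto simp: in_keys_iff)

text \<open>Provides \<open>span\<close>, \<open>independent\<close> and \<open>dim\<close> for
  polynomial spaces, with which generators of one bidegree are counted.\<close>

interpretation bipoly: vector_space "\<lambda>(c::'k::field_char_0) p. scalar c * p"
  by unfold_locales (simp_all add: scalar_add scalar_mult algebra_simps)

subsection \<open>Spans of monomials\<close>

definition mon_span :: "(4 \<Rightarrow>\<^sub>0 nat) set \<Rightarrow> ('k::field_char_0) bipoly set"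
  where "mon_span S = {p. keys p \<subseteq> S}"

definition bimon :: "nat \<Rightarrow> nat \<Rightarrow> (4 \<Rightarrow>\<^sub>0 nat) set"
  where "bimon a b = {m. lookup m 0 + lookup m 1 = a \<and> lookup m 2 + lookup m 3 = b}"

text \<open>Closure under multiplication by monomials, the condition that makes
  \<open>mon_span S\<close> an ideal.\<close>

definition upclosed :: "(4 \<Rightarrow>\<^sub>0 nat) set \<Rightarrow> bool"
  where "upclosed S \<longleftrightarrow> (\<forall>m\<in>S. \<forall>n. n + m \<in> S)"

lemma bihom_eq_mon_span: "bihom a b = mon_span (bimon a b)"
  by (auto simp: bihom_def mon_span_def bimon_def)

lemma mon_span_0 [simp]: "0 \<in> mon_span S"
  by (simp add: mon_span_def)

lemma mon_span_add: "p \<in> mon_span S \<Longrightarrow> q \<in> mon_span S \<Longrightarrow> p + q \<in> mon_span S"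
  using keys_add[of p q] by (auto simp: mon_span_def)

lemma mon_span_scalar: "p \<in> mon_span S \<Longrightarrow> scalar c * p \<in> mon_span S"
  using keys_scalar_mult[of c p] by (auto simp: mon_span_def)

lemma mon_span_single: "m \<in> S \<Longrightarrow> single m c \<in> mon_span S"
  by (auto simp: mon_span_def)

lemma mon_span_mult:
  assumes "p \<in> mon_span S" "q \<in> mon_span T" "\<And>m n. m \<in> S \<Longrightarrow> n \<in> T \<Longrightarrow> m + n \<in> U"
  shows "p * q \<in> mon_span U"
  using keys_mult[of p q] assms unfolding mon_span_def by blast

lemma bihom_0 [simp]: "0 \<in> bihom a b"
  by (simp add: bihom_eq_mon_span)

lemma bihom_add: "p \<in> bihom a b \<Longrightarrow> q \<in> bihom a b \<Longrightarrow> p + q \<in> bihom a b"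
  by (simp add: bihom_eq_mon_span mon_span_add)

lemma bihom_mult: "p \<in> bihom a b \<Longrightarrow> q \<in> bihom c d \<Longrightarrow> p * q \<in> bihom (a + c) (b + d)"
  unfolding bihom_eq_mon_span by (erule (1) mon_span_mult) (auto simp: bimon_def lookup_add)

lemma bihom_one: "1 \<in> bihom 0 0"
  by (simp add: bihom_def)

lemma bihom_power: "p \<in> bihom a b \<Longrightarrow> p ^ n \<in> bihom (n * a) (n * b)"
  by (induction n) (auto simp: bihom_one dest: bihom_mult)

lemma single_in_bihom: "m \<in> bimon a b \<Longrightarrow> single m c \<in> bihom a b"
  by (simp add: bihom_eq_mon_span mon_span_single)

subsection \<open>Substitution of variables\<close>

text \<open>The k-algebra endomorphism with prescribed values on the variables.\<close>

definition subst :: "(4 \<Rightarrow> ('k::field_char_0) bipoly) \<Rightarrow> 'k bipoly \<Rightarrow> 'k bipoly"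
  where "subst \<sigma> p = (\<Sum>m\<in>keys p. scalar (lookup p m) * (\<Prod>i\<in>UNIV. \<sigma> i ^ lookup m i))"

lemma subst_superset:
  assumes "finite A" "keys p \<subseteq> A"
  shows "subst \<sigma> p = (\<Sum>m\<in>A. scalar (lookup p m) * (\<Prod>i\<in>UNIV. \<sigma> i ^ lookup m i))"
  unfolding subst_def using assms
  by (intro sum.mono_neutral_left) (auto simp: in_keys_iff)

lemma subst_add: "subst \<sigma> (p + q) = subst \<sigma> p + subst \<sigma> q"
proof -
  have "keys (p + q) \<subseteq> keys p \<union> keys q"
    by (rule keys_add)
  then show ?thesis
    by (subst (1 2 3) subst_superset[where A = "keys p \<union> keys q"])
      (auto simp: lookup_add scalar_add distrib_right sum.distrib)
qed

lemma subst_single: "subst \<sigma> (single m c) = scalar c * (\<Prod>i\<in>UNIV. \<sigma> i ^ lookup m i)"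
  by (subst subst_superset[where A = "{m}"]) auto

lemma subst_0 [simp]: "subst \<sigma> 0 = 0"
  by (simp add: subst_def)

text \<open>Both sides are biadditive, so two nested inductions reduce the claim to monomials, where
  exponents add.\<close>

lemma subst_mult: "subst \<sigma> (p * q) = subst \<sigma> p * subst \<sigma> q"
proof -
  have singles: "subst \<sigma> (single m c * single n d) = subst \<sigma> (single m c) * subst \<sigma> (single n d)" for m n c d
    unfolding mult_single subst_single lookup_add power_add prod.distrib scalar_mult
    by (simp only: mult_ac)
  have "keys p \<subseteq> UNIV"
    by simp
  then show ?thesis
  proof (induction p rule: keys_induct)
    case (single m c)
    have "keys q \<subseteq> UNIV"
      by simp
    then show ?case
      by (induction q rule: keys_induct)
        (simp_all add: distrib_left subst_add singles)
  qed (simp_all add: distrib_right subst_add)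
qed

lemma subst_scalar: "subst \<sigma> (scalar c) = scalar c"
  using subst_single[of \<sigma> 0 c] by (simp flip: scalar_def)

abbreviation xvar :: "4 \<Rightarrow> ('k::field_char_0) bipoly"
  where "xvar i \<equiv> single (single i 1) 1"

lemma subst_xvar: "subst \<sigma> (xvar i) = \<sigma> i"
proof -
  have "(\<Prod>j\<in>UNIV. \<sigma> j ^ lookup (single i (1::nat)) j) = (\<Prod>j\<in>UNIV. if j = i then \<sigma> i else 1)"
    by (rule prod.cong) (auto simp: lookup_single)
  then show ?thesis
    by (simp add: subst_single)
qed

lemma xvar_power: "xvar i ^ n = single (single i n) 1"
  by (induction n) (auto simp: mult_single simp flip: single_add)

lemma single_eq_prod:
  fixes c :: "'k::field_char_0"
  shows "single m c = scalar c * (\<Prod>i\<in>UNIV. xvar i ^ lookup m i)"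
proof -
  have "(\<Prod>i\<in>UNIV. xvar i ^ lookup m i) = single m (1::'k)"
    unfolding UNIV_4
    by (simp add: xvar_power mult_single del: One_nat_def)
      (rule arg_cong[where f = "\<lambda>n. single n 1"], rule monomial_eqI,
        auto simp: lookup_add lookup_single)
  then show ?thesis
    by (simp add: scalar_mult_single del: One_nat_def)
qed

text \<open>The composite is an algebra homomorphism that fixes scalars and variables, hence every
  monomial and every polynomial.\<close>

lemma subst_inverse:
  assumes "\<And>i. subst \<sigma> (\<tau> i) = xvar i"
  shows "subst \<sigma> (subst \<tau> p) = p"
proof -
  have prod: "subst \<sigma> (prod f A) = (\<Prod>i\<in>A. subst \<sigma> (f i))" if "finite A" for f and A :: "4 set"
    using that by (induction A) (auto simp: subst_mult, metis scalar_1 subst_scalar)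
  have pow: "subst \<sigma> (p ^ n) = subst \<sigma> p ^ n" for p n
    by (induction n) (auto simp: subst_mult, metis scalar_1 subst_scalar)
  have "keys p \<subseteq> UNIV"
    by simp
  then show ?thesis
  proof (induction p rule: keys_induct)
    case (single m c)
    have "subst \<sigma> (subst \<tau> (single m c)) = scalar c * (\<Prod>i\<in>UNIV. xvar i ^ lookup m i)"
      by (simp only: subst_single[of \<tau>] subst_mult subst_scalar prod pow assms finite)
    then show ?case
      by (simp only: single_eq_prod[symmetric])
  qed (auto simp: subst_add)
qed

lemma subst_bihom:
  assumes "\<sigma> 0 \<in> bihom 1 0" "\<sigma> 1 \<in> bihom 1 0" "\<sigma> 2 \<in> bihom 0 1" "\<sigma> 3 \<in> bihom 0 1"
    and "p \<in> bihom a b"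
  shows "subst \<sigma> p \<in> bihom a b"
proof -
  have "keys p \<subseteq> bimon a b"
    using assms(5) by (auto simp: bihom_eq_mon_span mon_span_def)
  then show ?thesis
  proof (induction p rule: keys_induct)
    case (single m c)
    have "\<sigma> 0 ^ lookup m 0 * (\<sigma> 1 ^ lookup m 1 * (\<sigma> 2 ^ lookup m 2 * \<sigma> 3 ^ lookup m 3))
        \<in> bihom (lookup m 0 * 1 + (lookup m 1 * 1 + (lookup m 2 * 0 + lookup m 3 * 0)))
          (lookup m 0 * 0 + (lookup m 1 * 0 + (lookup m 2 * 1 + lookup m 3 * 1)))"
      by (intro bihom_mult bihom_power assms)
    then have "(\<Prod>i\<in>UNIV. \<sigma> i ^ lookup m i) \<in> bihom a b"
      using single unfolding UNIV_4 by (simp add: bimon_def)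
    then show ?case
      unfolding subst_single bihom_eq_mon_span by (rule mon_span_scalar)
  qed (auto simp: subst_add bihom_add)
qed

section \<open>Changes of coordinates\<close>

text \<open>A bigraded k-algebra automorphism. It carries the variables to the given forms, so that
  ideals, dimensions and generators can be computed with monomials and transported.\<close>

locale coord_change =
  fixes \<phi> :: "('k::field_char_0) bipoly \<Rightarrow> 'k bipoly"
  assumes add: "\<phi> (p + q) = \<phi> p + \<phi> q"
    and mult: "\<phi> (p * q) = \<phi> p * \<phi> q"
    and scalar: "\<phi> (scalar c) = scalar c"
    and bij: "bij \<phi>"
    and image_bihom: "\<phi> ` bihom a b = bihom a b"
begin

lemma inj: "\<phi> p = \<phi> q \<longleftrightarrow> p = q"
  using bij by (auto simp: bij_def inj_def)

lemma zero [simp]: "\<phi> 0 = 0"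
  using scalar[of 0] by simp

lemma scalar_mult: "\<phi> (scalar c * p) = scalar c * \<phi> p"
  by (simp add: mult scalar)

lemma bihom_eq_image: "bihom a b = \<phi> ` mon_span (bimon a b)"
  using image_bihom[of a b] by (simp add: bihom_eq_mon_span)

lemma surjE: obtains q where "p = \<phi> q"
  using bij by (auto simp: bij_def)

end

section \<open>Linear forms and their coefficient matrices\<close>

lemma mon_span_two_variables:
  assumes "f \<in> mon_span {single i 1, single j 1}" "i \<noteq> j"
  obtains a b where "f = scalar a * xvar i + scalar b * xvar j"
proof -
  have neq: "single i (1::nat) \<noteq> single j 1"
    using assms(2) by (metis lookup_single_eq lookup_single_not_eq zero_neq_one)
  have "f = (\<Sum>m\<in>{single i 1, single j 1}. single m (lookup f m))"
    using assms(1) by (subst poly_mapping_eq_sum, intro sum.mono_neutral_left)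
      (auto simp: mon_span_def in_keys_iff)
  then show ?thesis
    using neq by (intro that) (simp add: scalar_mult_single)
qed

lemma bimon_1_0: "bimon 1 0 = {single 0 1, single 1 1}"
  by (auto simp: bimon_def lookup_single intro!: monomial_eqI elim!: add_is_1[THEN iffD1, THEN disjE])

lemma bimon_0_1: "bimon 0 1 = {single 2 1, single 3 1}"
  by (auto simp: bimon_def lookup_single intro!: monomial_eqI elim!: add_is_1[THEN iffD1, THEN disjE])

text \<open>A vanishing determinant would make the forms proportional, so the coefficient matrix is
  invertible. Both products with the inverse are recorded because two substitutions must be shown
  mutually inverse.\<close>

lemma non_proportional_inverse:
  fixes a b c d :: "'k::field_char_0"
  assumes "\<not> proportional (scalar a * x + scalar b * y) (scalar c * x + scalar d * y)"
  obtains p q r s where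
    "p * a + q * c = 1" "p * b + q * d = 0" "r * a + s * c = 0" "r * b + s * d = 1"
    "a * p + b * r = 1" "a * q + b * s = 0" "c * p + d * r = 0" "c * q + d * s = 1"
proof -
  have "a * d - b * c \<noteq> 0"
  proof
    assume det: "a * d - b * c = 0"
    have combine: "scalar e * (scalar a * x + scalar b * y)
        = scalar (e * a) * x + scalar (e * b) * y" for a b e :: 'k
      by (simp add: scalar_mult algebra_simps)
    consider "a \<noteq> 0" | "a = 0" "b \<noteq> 0" | "a = 0" "b = 0"
      by blast
    then have "\<exists>e. (c = e * a \<and> d = e * b) \<or> (a = e * c \<and> b = e * d)"
    proof cases
      case 1
      then have "c = (c / a) * a \<and> d = (c / a) * b"
        using det by (simp add: field_simps)
      then show ?thesis by blast
    next
      case 2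
      then have "c = (d / b) * a \<and> d = (d / b) * b"
        using det by (simp add: field_simps)
      then show ?thesis by blast
    next
      case 3
      \<comment> \<open>If the first form has zero coefficients, it is 0 times the second.\<close>
      then show ?thesis by (intro exI[of _ 0]) simp
    qed
    then show False
      using assms unfolding proportional_def combine by metis
  qed
  then obtain e where "e * (a * d - b * c) = 1"
    by (metis left_inverse)
  then show ?thesis
    \<comment> \<open>The entries of the adjugate matrix, divided by the determinant.\<close>
    by (intro that[of "d * e" "- b * e" "- c * e" "a * e"]) (simp_all add: algebra_simps)
qed

lemma scalar_combine:
  "scalar p * (scalar a * x + scalar b * y) + scalar q * (scalar c * x + scalar d * y)
    = scalar (p * a + q * c) * x + scalar (p * b + q * d) * y"
  by (simp add: scalar_mult scalar_add algebra_simps)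

lemma xvar_bihom:
  "xvar 0 \<in> bihom 1 0" "xvar 1 \<in> bihom 1 0" "xvar 2 \<in> bihom 0 1" "xvar 3 \<in> bihom 0 1"
  by (auto intro!: single_in_bihom simp: bimon_def lookup_single)

lemma coord_change_exists:
  fixes H1 H2 V1 V2 :: "('k::field_char_0) bipoly"
  assumes H: "H1 \<in> bihom 1 0" "H2 \<in> bihom 1 0" "\<not> proportional H1 H2"
    and V: "V1 \<in> bihom 0 1" "V2 \<in> bihom 0 1" "\<not> proportional V1 V2"
  obtains \<phi> where "coord_change \<phi>" "\<phi> (xvar 0) = H1" "\<phi> (xvar 1) = H2"
    "\<phi> (xvar 2) = V1" "\<phi> (xvar 3) = V2"
proof -
  obtain a b c d where H_eq:
    "H1 = scalar a * xvar 0 + scalar b * xvar 1" "H2 = scalar c * xvar 0 + scalar d * xvar 1"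
    using H(1,2) by (metis bihom_eq_mon_span bimon_1_0 distinct_4(1) mon_span_two_variables)
  obtain a' b' c' d' where V_eq:
    "V1 = scalar a' * xvar 2 + scalar b' * xvar 3" "V2 = scalar c' * xvar 2 + scalar d' * xvar 3"
    using V(1,2) by (metis bihom_eq_mon_span bimon_0_1 distinct_4(6) mon_span_two_variables)
  obtain p q r s where inv:
    "p * a + q * c = 1" "p * b + q * d = 0" "r * a + s * c = 0" "r * b + s * d = 1"
    "a * p + b * r = 1" "a * q + b * s = 0" "c * p + d * r = 0" "c * q + d * s = 1"
    using H(3) unfolding H_eq by (rule non_proportional_inverse)
  obtain p' q' r' s' where inv':
    "p' * a' + q' * c' = 1" "p' * b' + q' * d' = 0" "r' * a' + s' * c' = 0" "r' * b' + s' * d' = 1"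
    "a' * p' + b' * r' = 1" "a' * q' + b' * s' = 0" "c' * p' + d' * r' = 0" "c' * q' + d' * s' = 1"
    using V(3) unfolding V_eq by (rule non_proportional_inverse)
  \<comment> \<open>\<open>\<sigma>\<close> sends the variables to the given forms;
    \<open>\<tau>\<close> uses the inverse matrices. Composing them on variables multiplies the
    matrices, by \<open>scalar_combine\<close>.\<close>
  define \<sigma> where "\<sigma> = (\<lambda>i::4. if i = 0 then H1 else if i = 1 then H2 else if i = 2 then V1 else V2)"
  define \<tau> :: "4 \<Rightarrow> 'k bipoly" where "\<tau> = (\<lambda>i::4.
      if i = 0 then scalar p * xvar 0 + scalar q * xvar 1
      else if i = 1 then scalar r * xvar 0 + scalar s * xvar 1
      else if i = 2 then scalar p' * xvar 2 + scalar q' * xvar 3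
      else scalar r' * xvar 2 + scalar s' * xvar 3)"
  have \<sigma>: "\<sigma> 0 = H1" "\<sigma> 1 = H2" "\<sigma> 2 = V1" "\<sigma> 3 = V2"
    unfolding \<sigma>_def by simp_all
  have \<tau>: "\<tau> 0 = scalar p * xvar 0 + scalar q * xvar 1"
    "\<tau> 1 = scalar r * xvar 0 + scalar s * xvar 1"
    "\<tau> 2 = scalar p' * xvar 2 + scalar q' * xvar 3"
    "\<tau> 3 = scalar r' * xvar 2 + scalar s' * xvar 3"
    unfolding \<tau>_def by simp_all
  have all4: "P i" if "P 0" "P 1" "P 2" "P 3" for P and i :: 4
    using that UNIV_4 UNIV_I by (metis empty_iff insert_iff)
  have \<sigma>\<tau>: "subst \<sigma> (\<tau> i) = xvar i" for i
    by (rule all4[of "\<lambda>i. subst \<sigma> (\<tau> i) = xvar i"])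
      (simp_all only: \<tau> subst_add subst_mult subst_scalar subst_xvar \<sigma> H_eq V_eq
        scalar_combine inv inv' scalar_0 scalar_1 mult_zero_left mult_1_left add_0 add_0_right)
  have \<tau>\<sigma>: "subst \<tau> (\<sigma> i) = xvar i" for i
    by (rule all4[of "\<lambda>i. subst \<tau> (\<sigma> i) = xvar i"])
      (simp_all only: \<tau> subst_add subst_mult subst_scalar subst_xvar \<sigma> H_eq V_eq
        scalar_combine inv inv' scalar_0 scalar_1 mult_zero_left mult_1_left add_0 add_0_right)
  have \<sigma>_bihom: "subst \<sigma> f \<in> bihom m n" if "f \<in> bihom m n" for f m n
    by (rule subst_bihom) (use that H V \<sigma> in simp_all)
  have form: "scalar e * x + scalar f * y \<in> bihom m n" if "x \<in> bihom m n" "y \<in> bihom m n"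
    for e f m n and x y :: "'k bipoly"
    using that by (simp add: bihom_eq_mon_span mon_span_add mon_span_scalar)
  have \<tau>_bihom: "subst \<tau> f \<in> bihom m n" if "f \<in> bihom m n" for f m n
    by (rule subst_bihom) (simp_all only: \<tau> form xvar_bihom that)
  have inverse: "subst \<sigma> (subst \<tau> f) = f" "subst \<tau> (subst \<sigma> f) = f" for f
    by (simp_all add: subst_inverse \<sigma>\<tau> \<tau>\<sigma>)
  have "coord_change (subst \<sigma>)"
  proof
    show "bij (subst \<sigma>)"
      by (rule o_bij[of "subst \<tau>"]) (auto simp: inverse)
    show "subst \<sigma> ` bihom m n = bihom m n" for m n
      using \<sigma>_bihom \<tau>_bihom inverse(1) by (auto simp: image_iff) metis
  qed (simp_all add: subst_add subst_mult subst_scalar)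
  then show ?thesis
    by (rule that) (simp_all only: subst_xvar \<sigma>)
qed

section \<open>Ideals spanned by monomials\<close>

text \<open>Closure under negation comes from multiplication by -1.\<close>

lemma ideal_type_algebra_iff:
  fixes I :: "'a::comm_ring_1 set"
  shows "ideal I ring_of_type_algebra \<longleftrightarrow>
    0 \<in> I \<and> (\<forall>x\<in>I. \<forall>y\<in>I. x + y \<in> I) \<and> (\<forall>r. \<forall>x\<in>I. r * x \<in> I)"
    (is "?L \<longleftrightarrow> ?R")
proof
  assume ?L
  then interpret ideal I "ring_of_type_algebra :: 'a ring" .
  show ?R
    using additive_subgroup.zero_closed[OF is_additive_subgroup]
      additive_subgroup.a_closed[OF is_additive_subgroup] I_l_closed by auto
next
  assume R: ?R
  interpret cring "ring_of_type_algebra :: 'a ring"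
    by (rule cring_from_type_algebra)
  have a_inv: "\<ominus>\<^bsub>ring_of_type_algebra\<^esub> x = - x" for x :: 'a
    using minus_equality[of "- x" x] by simp
  show ?L
  proof (rule idealI)
    show "subgroup I (add_monoid (ring_of_type_algebra :: 'a ring))"
    proof (rule add.subgroupI)
      fix x assume "x \<in> I"
      then have "(- 1) * x \<in> I"
        using R by blast
      then show "\<ominus>\<^bsub>ring_of_type_algebra\<^esub> x \<in> I"
        by (simp add: a_inv)
    qed (use R in auto)
    fix a x :: 'a assume "a \<in> I"
    then have "x * a \<in> I"
      using R by blast
    then show "x \<otimes>\<^bsub>ring_of_type_algebra\<^esub> a \<in> I" "a \<otimes>\<^bsub>ring_of_type_algebra\<^esub> x \<in> I"
      by (simp_all add: mult.commute)
  qed (rule ring_axioms)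
qed

lemma genideal_ideal_type_algebra: "ideal (Idl\<^bsub>ring_of_type_algebra\<^esub> S) (ring_of_type_algebra :: 'a::comm_ring_1 ring)"
  by (rule ring.genideal_ideal) auto

lemma genideal_superset_type_algebra: "S \<subseteq> Idl\<^bsub>ring_of_type_algebra\<^esub> (S :: 'a::comm_ring_1 set)"
  by (rule ring.genideal_self) auto

lemma genideal_subset_type_algebra:
  "ideal J (ring_of_type_algebra :: 'a::comm_ring_1 ring) \<Longrightarrow> S \<subseteq> J \<Longrightarrow> Idl\<^bsub>ring_of_type_algebra\<^esub> S \<subseteq> J"
  by (rule ring.genideal_minimal) auto

section \<open>Monomial ideals in new coordinates and powers of point ideals\<close>

context coord_change
begin

lemma ideal_image_mon_span:
  assumes "upclosed S"
  shows "ideal (\<phi> ` mon_span S) \<R>"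
  unfolding ideal_type_algebra_iff
proof (intro conjI ballI allI)
  show "0 \<in> \<phi> ` mon_span S"
    by (rule image_eqI[of _ _ 0]) simp_all
next
  fix x y assume "x \<in> \<phi> ` mon_span S" "y \<in> \<phi> ` mon_span S"
  then show "x + y \<in> \<phi> ` mon_span S"
    by (auto simp flip: add intro: mon_span_add)
next
  fix r x assume "x \<in> \<phi> ` mon_span S"
  then obtain q where q: "x = \<phi> q" "q \<in> mon_span S"
    by blast
  obtain s where s: "r = \<phi> s"
    by (rule surjE)
  have "s * q \<in> mon_span S"
    by (rule mon_span_mult[of _ UNIV _ S]) (use q assms in \<open>auto simp: upclosed_def mon_span_def\<close>)
  then show "r * x \<in> \<phi> ` mon_span S"
    by (auto simp: q s simp flip: mult)
qed

lemma image_mon_span_subset: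
  assumes "ideal J \<R>" "\<And>m. m \<in> S \<Longrightarrow> \<phi> (single m 1) \<in> J"
  shows "\<phi> ` mon_span S \<subseteq> J"
proof (rule image_subsetI)
  fix q :: "'k bipoly" assume "q \<in> mon_span S"
  then have "keys q \<subseteq> S"
    by (simp add: mon_span_def)
  then show "\<phi> q \<in> J"
  proof (induction q rule: keys_induct)
    case (single m c)
    have "\<phi> (single m c) = scalar c * \<phi> (single m 1)"
      by (simp flip: scalar_mult add: scalar_mult_single)
    then show ?case
      using single assms by (simp add: ideal_type_algebra_iff)
  qed (use assms in \<open>auto simp: ideal_type_algebra_iff add\<close>)
qed

text \<open>A monomial of degree at least \<open>n + 1\<close> in the two variables is one of them
  times a monomial of degree at least \<open>n\<close>. Hence each further factor of the point ideal
  raises the threshold by one.\<close>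

lemma point_ideal_power:
  assumes "i \<noteq> j"
  shows "point_ideal (\<phi> (xvar i)) (\<phi> (xvar j)) [^]\<^bsub>ideals_set \<R>\<^esub> n
    = \<phi> ` mon_span {m. n \<le> lookup m i + lookup m j}"
proof (induction n)
  case 0
  \<comment> \<open>The zeroth power is the whole ring, and the threshold 0 admits every
    monomial.\<close>
  have "\<phi> ` mon_span UNIV = UNIV"
    using bij by (simp add: mon_span_def bij_def)
  then show ?case
    by (simp add: ideals_set_def nat_pow_def)
next
  case (Suc n)
  define T where "T n = {m. n \<le> lookup m i + lookup m j}" for n :: nat
  define P where "P = point_ideal (\<phi> (xvar i)) (\<phi> (xvar j))"
  have T_up: "upclosed (T n)" for n
    by (auto simp: upclosed_def T_def lookup_add)
  have P_ideal: "ideal P \<R>"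
    unfolding P_def point_ideal_def by (rule genideal_ideal_type_algebra)
  have P_gens: "\<phi> (xvar i) \<in> P" "\<phi> (xvar j) \<in> P"
    unfolding P_def point_ideal_def using genideal_superset_type_algebra by blast+
  have P_sub: "P \<subseteq> \<phi> ` mon_span (T 1)"
    unfolding P_def point_ideal_def
    by (rule genideal_subset_type_algebra[OF ideal_image_mon_span[OF T_up]])
      (auto simp: T_def intro!: imageI mon_span_single)
  have "point_ideal (\<phi> (xvar i)) (\<phi> (xvar j)) [^]\<^bsub>ideals_set \<R>\<^esub> Suc n = \<phi> ` mon_span (T n) \<cdot>\<^bsub>\<R>\<^esub> P"
    using Suc by (simp add: ideals_set_def nat_pow_def P_def T_def)
  also have "\<dots> = \<phi> ` mon_span (T (Suc n))"
  proof
    show "\<phi> ` mon_span (T n) \<cdot>\<^bsub>\<R>\<^esub> P \<subseteq> \<phi> ` mon_span (T (Suc n))"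
    proof
      fix x assume "x \<in> \<phi> ` mon_span (T n) \<cdot>\<^bsub>\<R>\<^esub> P"
      then show "x \<in> \<phi> ` mon_span (T (Suc n))"
      proof (induction x rule: ideal_prod.induct)
        case (prod x y)
        then obtain p q where "x = \<phi> p" "p \<in> mon_span (T n)" "y = \<phi> q" "q \<in> mon_span (T 1)"
          using P_sub by blast
        moreover from this have "p * q \<in> mon_span (T (Suc n))"
          by (elim mon_span_mult) (auto simp: T_def lookup_add)
        ultimately show ?case
          by (auto simp flip: mult)
      next
        case (sum x y)
        then show ?case
          by (auto simp flip: add intro: mon_span_add)
      qed
    qed
    have ideal: "ideal (\<phi> ` mon_span (T n) \<cdot>\<^bsub>\<R>\<^esub> P) \<R>"
      by (intro ring.ideal_prod_is_ideal ring_from_type_algebra ideal_image_mon_span T_up P_ideal)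
    have step: "\<phi> (single m 1) \<in> \<phi> ` mon_span (T n) \<cdot>\<^bsub>\<R>\<^esub> P"
      if "m \<in> T (Suc n)" "lookup m l \<noteq> 0" "l = i \<or> l = j" for m l
    proof -
      \<comment> \<open>Divide by a variable \<open>l\<close> that occurs in \<open>m\<close>. As
        \<open>i\<close> and \<open>j\<close> differ, this lowers the degree in the two variables by
        exactly one.\<close>
      define m' where "m' = m - single l 1"
      have m: "m = m' + single l 1"
        using that(2) by (intro poly_mapping_eqI) (auto simp: m'_def lookup_add lookup_minus lookup_single when_def)
      then have "m' \<in> T n"
        using that assms by (auto simp: T_def lookup_add lookup_single)
      then have "\<phi> (single m' 1) \<in> \<phi> ` mon_span (T n)"
        by (intro imageI mon_span_single)
      moreover have "\<phi> (xvar l) \<in> P"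
        using that(3) P_gens by auto
      ultimately have "\<phi> (single m' 1) * \<phi> (xvar l) \<in> \<phi> ` mon_span (T n) \<cdot>\<^bsub>\<R>\<^esub> P"
        using ideal_prod.prod[of _ _ _ P \<R>] by fastforce
      then show ?thesis
        by (simp add: m mult_single flip: mult)
    qed
    show "\<phi> ` mon_span (T (Suc n)) \<subseteq> \<phi> ` mon_span (T n) \<cdot>\<^bsub>\<R>\<^esub> P"
    proof (rule image_mon_span_subset[OF ideal])
      fix m assume m: "m \<in> T (Suc n)"
      then have "lookup m i \<noteq> 0 \<or> lookup m j \<noteq> 0"
        by (auto simp: T_def)
      then show "\<phi> (single m 1) \<in> \<phi> ` mon_span (T n) \<cdot>\<^bsub>\<R>\<^esub> P"
        using step m by blast
    qed
  qed
  finally show ?case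
    by (simp add: T_def)
qed

lemma image_mon_span_Int: "\<phi> ` mon_span S \<inter> \<phi> ` mon_span T = \<phi> ` mon_span (S \<inter> T)"
  by (auto simp: mon_span_def inj)

end

section \<open>Hilbert functions\<close>

text \<open>The linear projection onto \<open>mon_span S\<close> along the remaining monomials; for
  \<open>S = bimon a b\<close> it extracts a bihomogeneous component.\<close>

definition restr :: "(4 \<Rightarrow>\<^sub>0 nat) set \<Rightarrow> ('k::field_char_0) bipoly \<Rightarrow> 'k bipoly"
  where "restr S p = Poly_Mapping.mapp (\<lambda>m c. if m \<in> S then c else 0) p"

lemma lookup_restr: "lookup (restr S p) m = (if m \<in> S then lookup p m else 0)"
  by (auto simp: restr_def lookup_mapp in_keys_iff when_def)

lemma restr_mem: "restr S p \<in> mon_span S"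
  by (auto simp: mon_span_def in_keys_iff lookup_restr split: if_splits)

lemma restr_eq_self: "p \<in> mon_span S \<Longrightarrow> restr S p = p"
  by (rule poly_mapping_eqI) (auto simp: lookup_restr mon_span_def in_keys_iff)

lemma restr_eq_0: "p \<in> mon_span T \<Longrightarrow> S \<inter> T = {} \<Longrightarrow> restr S p = 0"
  by (rule poly_mapping_eqI) (auto simp: lookup_restr mon_span_def in_keys_iff)

lemma restr_add: "restr S (p + q) = restr S p + restr S q"
  by (rule poly_mapping_eqI) (auto simp: lookup_restr lookup_add)

lemma restr_scalar: "restr S (scalar c * p) = scalar c * restr S p"
  by (rule poly_mapping_eqI) (auto simp: lookup_restr)

lemma finite_bounded_monomials: "finite {m :: 4 \<Rightarrow>\<^sub>0 nat. \<forall>i. lookup m i \<le> N}"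
proof (rule finite_imageD)
  have "lookup ` {m :: 4 \<Rightarrow>\<^sub>0 nat. \<forall>i. lookup m i \<le> N} \<subseteq> (\<Pi>\<^sub>E i\<in>UNIV. {..N})"
    by auto
  then show "finite (lookup ` {m :: 4 \<Rightarrow>\<^sub>0 nat. \<forall>i. lookup m i \<le> N})"
    by (rule finite_subset) (simp add: finite_PiE)
qed (auto intro: inj_onI poly_mapping_eqI)

section \<open>Monomials of a fixed bidegree\<close>

lemma monomial4:
  obtains m :: "4 \<Rightarrow>\<^sub>0 nat"
  where "lookup m 0 = i" "lookup m 1 = j" "lookup m 2 = k" "lookup m 3 = l"
  by (rule that[of "single 0 i + single 1 j + single 2 k + single 3 l"])
    (simp_all add: lookup_add lookup_single)

lemma bij_betw_bimon:
  "bij_betw (\<lambda>m. (lookup m 0, lookup m 2)) (bimon a b) ({..a} \<times> {..b})"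
proof (rule bij_betw_imageI)
  show "inj_on (\<lambda>m. (lookup m 0, lookup m 2)) (bimon a b)"
    by (rule inj_onI) (auto simp: bimon_def intro!: monomial_eqI)
  have "(i, k) \<in> (\<lambda>m. (lookup m 0, lookup m 2)) ` bimon a b" if ik: "i \<le> a" "k \<le> b" for i k
  proof -
    obtain m :: "4 \<Rightarrow>\<^sub>0 nat" where "lookup m 0 = i" "lookup m 1 = a - i" "lookup m 2 = k" "lookup m 3 = b - k"
      by (rule monomial4)
    then show ?thesis
      using ik by (intro image_eqI[of _ _ m]) (auto simp: bimon_def)
  qed
  then show "(\<lambda>m. (lookup m 0, lookup m 2)) ` bimon a b = {..a} \<times> {..b}"
    by (auto simp: bimon_def)
qed

lemma finite_bimon [simp]: "finite (bimon a b)"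
  using bij_betw_finite[OF bij_betw_bimon] by simp

lemma card_bimon: "card (bimon a b) = Suc a * Suc b"
  using bij_betw_same_card[OF bij_betw_bimon] by (simp add: card_cartesian_product)

lemma subfield_scalars: "subfield (range scalar) (\<R> :: ('k::field_char_0) bipoly ring)"
proof -
  interpret cring "\<R> :: 'k bipoly ring"
    by (rule cring_from_type_algebra)
  have a_inv: "\<ominus>\<^bsub>\<R>\<^esub> x = - x" for x :: "'k bipoly"
    using minus_equality[of "- x" x] by simp
  have uminus: "- scalar c = scalar (- c)" for c :: 'k
    by (simp add: scalar_def single_uminus)
  show ?thesis
  proof (rule subfieldI)
    show "subcring (range scalar) (\<R> :: 'k bipoly ring)"
    proof (rule subcringI', rule subringI)
      show "\<one>\<^bsub>\<R>\<^esub> \<in> range (scalar :: 'k \<Rightarrow> _)"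
        unfolding ring_of_type_algebra_simps by (metis rangeI scalar_1)
    qed (auto simp: a_inv uminus simp flip: scalar_add scalar_mult)
    show "Units ((\<R> :: 'k bipoly ring)\<lparr>carrier := range scalar\<rparr>) = range scalar - {\<zero>\<^bsub>\<R>\<^esub>}"
    proof
      have "(0 :: 'k bipoly) \<noteq> 1"
        by simp
      then show "Units ((\<R> :: 'k bipoly ring)\<lparr>carrier := range scalar\<rparr>) \<subseteq> range scalar - {\<zero>\<^bsub>\<R>\<^esub>}"
        by (auto simp: Units_def)
      have "scalar c \<in> Units (\<R>\<lparr>carrier := range scalar\<rparr>)" if "scalar c \<noteq> 0" for c :: 'k
      proof -
        have "c \<noteq> 0"
          using that by auto
        then have "scalar (inverse c) * scalar c = 1" "scalar c * scalar (inverse c) = 1"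
          by (simp_all flip: scalar_mult)
        then show ?thesis
          unfolding Units_def by auto
      qed
      then show "range scalar - {\<zero>\<^bsub>\<R>\<^esub>} \<subseteq> Units ((\<R> :: 'k bipoly ring)\<lparr>carrier := range scalar\<rparr>)"
        by auto
    qed
  qed
qed

text \<open>
  In the zero ring \<open>K\<close> is not a subfield, so the uniqueness of dimension has to be checked by hand.
\<close>

lemma (in ring) dimension_zero_ring:
  assumes "dimension n K E" "\<one> = \<zero>"
  shows "n = 0"
  using assms
proof (induction rule: dimension.induct)
  case (Suc_dim v E n K)
  then have "dimension 0 K E"
    by simp
  then have "E = {\<zero>}"
    by (cases rule: dimension.cases) auto
  moreover have "v = \<zero>"
    using Suc_dim by (metis l_null l_one)
  ultimately show ?case
    using Suc_dim by simp
qed simp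

section \<open>Hilbert functions of transported monomial ideals\<close>

context coord_change
begin

text \<open>The residue classes of the monomials outside \<open>S\<close> form a basis of the
  quotient component. Adjoining them one by one follows the inductive definition of
  \<open>dimension\<close>.\<close>

lemma hilbert_fun_image:
  assumes S: "upclosed S"
  shows "hilbert_fun (\<phi> ` mon_span S) (int a) (int b) = int (card (bimon a b - S))"
proof -
  define I where "I = \<phi> ` mon_span S"
  define \<pi> where "\<pi> f = I +>\<^bsub>\<R>\<^esub> f" for f
  define Q where "Q = \<R> Quot I"
  define K where "K = \<pi> ` range scalar"
  have ideal: "ideal I \<R>"
    unfolding I_def by (rule ideal_image_mon_span[OF S])
  interpret \<pi>: ring_hom_ring \<R> Q \<pi>
    unfolding Q_def \<pi>_def using ideal.rcos_ring_hom_ring[OF ideal] by (simp add: \<pi>_def)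
  have hom: "\<pi> (f + g) = \<pi> f \<oplus>\<^bsub>Q\<^esub> \<pi> g" "\<pi> (f * g) = \<pi> f \<otimes>\<^bsub>Q\<^esub> \<pi> g" for f g
    using \<pi>.hom_add[of f g] \<pi>.hom_mult[of f g] by simp_all
  have carrier: "\<pi> f \<in> carrier Q" for f
    using \<pi>.hom_closed[of f] by simp
  have \<pi>_self: "f \<in> \<pi> f" for f
    unfolding \<pi>_def using ideal
    by (auto simp: a_r_coset_def' ideal_type_algebra_iff intro!: bexI[of _ 0])
  have \<pi>_mem: "\<exists>h\<in>I. g = h + f" if "\<pi> f = \<pi> g" for f g
    using \<pi>_self[of g] unfolding that[symmetric] by (auto simp: \<pi>_def a_r_coset_def')
  have \<pi>_I: "\<pi> (h + f) = \<pi> f" if "h \<in> I" for h f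
  proof -
    have "x - h \<in> I \<longleftrightarrow> x \<in> I" for x
    proof -
      have "x + (- 1) * h \<in> I" if "x \<in> I"
        using ideal \<open>h \<in> I\<close> that by (simp only: ideal_type_algebra_iff)
      moreover have "(x - h) + h \<in> I" if "x - h \<in> I"
        using ideal \<open>h \<in> I\<close> that by (simp only: ideal_type_algebra_iff)
      ultimately show ?thesis
        by auto
    qed
    moreover have "\<pi> f = {g. g - f \<in> I}" for f
    proof -
      have "g = (g - f) + f" for g
        by simp
      then show ?thesis
        by (auto simp: \<pi>_def a_r_coset_def')
    qed
    moreover have "g - (h + f) = (g - f) - h" for g
      by simp
    ultimately show ?thesis
      by (simp only:)
  qed
  have dimension: "\<pi>.S.dimension (card F) K (\<pi> ` \<phi> ` mon_span F)"
    if "finite F" "F \<inter> S = {}" for F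
    using that
  proof (induction F)
    case empty
    have "mon_span {} = {0 :: 'k bipoly}"
      by (auto simp: mon_span_def)
    then show ?case
      using \<pi>.hom_zero by simp
  next
    case (insert m F)
    let ?v = "\<pi> (\<phi> (single m 1))" and ?E = "\<pi> ` \<phi> ` mon_span F"
    \<comment> \<open>Otherwise the new monomial would agree modulo the ideal with a combination
      from \<open>F\<close>; but neither that combination nor an element of
      \<open>mon_span S\<close> has a term at \<open>m\<close>.\<close>
    have "?v \<notin> ?E"
    proof
      assume "?v \<in> ?E"
      then obtain q where q: "q \<in> mon_span F" "?v = \<pi> (\<phi> q)"
        by blast
      then obtain s where s: "s \<in> mon_span S" "\<phi> q = \<phi> s + \<phi> (single m 1)"
        using \<pi>_mem[of "\<phi> (single m 1)" "\<phi> q"] by (auto simp: I_def)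
      then have "q = s + single m 1"
        by (simp flip: add add: inj)
      then have "lookup q m = lookup s m + 1"
        by (simp add: lookup_add)
      moreover have "lookup q m = 0" "lookup s m = 0"
        using q s insert by (auto simp: mon_span_def in_keys_iff)
      ultimately show False
        by simp
    qed
    then have "\<pi>.S.dimension (Suc (card F)) K (\<pi>.S.line_extension K ?v ?E)"
      using insert carrier by (intro \<pi>.S.dimension.Suc_dim) auto
    moreover have "\<pi>.S.line_extension K ?v ?E = \<pi> ` \<phi> ` mon_span (insert m F)"
    proof (intro equalityI subsetI)
      fix u assume "u \<in> \<pi>.S.line_extension K ?v ?E"
      then obtain c q where q: "q \<in> mon_span F" "u = \<pi> (scalar c) \<otimes>\<^bsub>Q\<^esub> ?v \<oplus>\<^bsub>Q\<^esub> \<pi> (\<phi> q)"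
        by (auto simp: \<pi>.S.line_extension_mem_iff K_def)
      then have "u = \<pi> (\<phi> (scalar c * single m 1 + q))"
        by (simp add: hom add scalar_mult)
      moreover have "scalar c * single m 1 + q \<in> mon_span (insert m F)"
        using q(1) by (intro mon_span_add mon_span_scalar mon_span_single) (auto simp: mon_span_def)
      ultimately show "u \<in> \<pi> ` \<phi> ` mon_span (insert m F)"
        by blast
    next
      fix u assume "u \<in> \<pi> ` \<phi> ` mon_span (insert m F)"
      then obtain p where p: "p \<in> mon_span (insert m F)" "u = \<pi> (\<phi> p)"
        by blast
      have "p = scalar (lookup p m) * single m 1 + restr F p"
        using p(1) insert(2) by (intro poly_mapping_eqI)
          (auto simp: lookup_add lookup_single lookup_restr mon_span_def in_keys_iff when_def)
      then have "u = \<pi> (scalar (lookup p m)) \<otimes>\<^bsub>Q\<^esub> ?v \<oplus>\<^bsub>Q\<^esub> \<pi> (\<phi> (restr F p))"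
        unfolding p(2) by (metis add hom scalar_mult)
      moreover have "restr F p \<in> mon_span F"
        by (rule restr_mem)
      ultimately show "u \<in> \<pi>.S.line_extension K ?v ?E"
        by (auto simp: \<pi>.S.line_extension_mem_iff K_def)
    qed
    ultimately show ?case
      using insert by simp
  qed
  have "\<pi> ` bihom a b = \<pi> ` \<phi> ` mon_span (bimon a b - S)"
  proof (intro equalityI subsetI)
    fix u assume "u \<in> \<pi> ` bihom a b"
    then obtain p where p: "p \<in> mon_span (bimon a b)" "u = \<pi> (\<phi> p)"
      by (auto simp: bihom_eq_image)
    \<comment> \<open>The part supported in \<open>S\<close> lies in the ideal and vanishes in the
      quotient.\<close>
    have "p = restr S p + restr (bimon a b - S) p"
      using p(1) by (intro poly_mapping_eqI)
        (auto simp: lookup_add lookup_restr mon_span_def in_keys_iff)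
    then have "u = \<pi> (\<phi> (restr S p) + \<phi> (restr (bimon a b - S) p))"
      using p(2) by (metis add)
    also have "\<dots> = \<pi> (\<phi> (restr (bimon a b - S) p))"
      by (rule \<pi>_I) (auto simp: I_def intro!: imageI restr_mem)
    finally show "u \<in> \<pi> ` \<phi> ` mon_span (bimon a b - S)"
      by (auto intro!: imageI restr_mem)
  next
    fix u assume "u \<in> \<pi> ` \<phi> ` mon_span (bimon a b - S)"
    then show "u \<in> \<pi> ` bihom a b"
      by (auto simp: bihom_eq_image mon_span_def)
  qed
  then have dim: "\<pi>.S.dimension (card (bimon a b - S)) K (\<pi> ` bihom a b)"
    using dimension[of "bimon a b - S"] by auto
  have "(\<pi>.S.dim over K) (\<pi> ` bihom a b) = card (bimon a b - S)"
  \<comment> \<open>The first case is the unit ideal, where \<open>K\<close> is not a subfield and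
    every dimension is 0.\<close>
  proof (cases "\<one>\<^bsub>Q\<^esub> = \<zero>\<^bsub>Q\<^esub>")
    case True
    then show ?thesis
      unfolding over_def \<pi>.S.dim_def using dim \<pi>.S.dimension_zero_ring
      by (intro the_equality) (auto dest: \<pi>.S.dimension_zero_ring)
  next
    case False
    then have "subfield K Q"
      unfolding K_def by (intro \<pi>.img_is_subfield subfield_scalars)
    then show ?thesis
      using dim by (rule \<pi>.S.dimI)
  qed
  then show ?thesis
    by (simp add: hilbert_fun_def I_def[symmetric] Q_def K_def \<pi>_def image_image cong: image_cong)
qed

end

section \<open>Generators of minimal degree\<close>

text \<open>All generators have total degree at least \<open>a + b\<close>, so multiplying by a
  nonconstant monomial contributes nothing in bidegree \<open>(a, b)\<close>. Every minimal
  generating set therefore meets this component in a basis, and the number in \<open>betti0\<close>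
  is well defined.\<close>

lemma betti0_initial:
  fixes G0 :: "('k::field_char_0) bipoly set"
  assumes "finite G0" "G0 \<subseteq> (\<Union>a b. bihom a b)"
    and degrees: "G0 \<subseteq> mon_span {m. a + b \<le> lookup m 0 + lookup m 1 + lookup m 2 + lookup m 3}"
      (is "_ \<subseteq> mon_span ?T")
  defines "I \<equiv> Idl\<^bsub>\<R>\<^esub> G0"
  shows "betti0 I a b = bipoly.dim (I \<inter> bihom a b)"
proof -
  have T: "ideal (mon_span ?T) (\<R> :: 'k bipoly ring)"
    unfolding ideal_type_algebra_iff
    by (auto intro: mon_span_add) (rule mon_span_mult[of _ UNIV _ ?T], auto simp: mon_span_def lookup_add)
  have I_T: "I \<subseteq> mon_span ?T"
    unfolding I_def using T degrees by (rule genideal_subset_type_algebra)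
  have subspace_ideal: "bipoly.subspace J" if "ideal J \<R>" for J :: "'k bipoly set"
    using that by (simp add: ideal_type_algebra_iff bipoly.subspace_def)
  have subspace_bihom: "bipoly.subspace (bihom a b :: 'k bipoly set)"
    by (auto simp: bipoly.subspace_def bihom_eq_mon_span mon_span_add mon_span_scalar)
  have I_ideal: "ideal I \<R>"
    unfolding I_def by (rule genideal_ideal_type_algebra)
  have card: "card (G \<inter> bihom a b) = bipoly.dim (I \<inter> bihom a b)" if G: "min_bihom_gens I G" for G
  proof -
    let ?B = "G \<inter> bihom a b"
    have GI: "G \<subseteq> I"
      using G genideal_superset_type_algebra[of G] by (auto simp: min_bihom_gens_def)
    \<comment> \<open>\<open>J\<close> asks that the component of bidegree \<open>(a, b)\<close> be
      spanned by generators of that bidegree. It is an ideal containing \<open>G\<close>, so it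
      contains \<open>I\<close>.\<close>
    define J where "J = {f \<in> mon_span ?T. restr (bimon a b) f \<in> bipoly.span ?B}"
    have "ideal J \<R>"
      unfolding ideal_type_algebra_iff
    proof (intro conjI ballI allI)
      have "restr (bimon a b) 0 = (0 :: 'k bipoly)"
        by (rule restr_eq_0[of _ "{}"]) simp_all
      then show "0 \<in> J"
        by (simp add: J_def bipoly.span_zero)
      show "f + g \<in> J" if "f \<in> J" "g \<in> J" for f g
        using that by (simp add: J_def mon_span_add restr_add bipoly.span_add)
      show "r * f \<in> J" if f: "f \<in> J" for r f
      proof -
        have "keys r \<subseteq> UNIV"
          by simp
        then have "restr (bimon a b) (r * f) \<in> bipoly.span ?B"
        proof (induction r rule: keys_induct)
          case zero
          then show ?case
            using \<open>0 \<in> J\<close> by (simp add: J_def)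
        next
          case (add p q)
          then show ?case
            by (simp add: distrib_right restr_add bipoly.span_add)
        next
          case (single m c)
          show ?case
          proof (cases "m = 0")
            case True
            then show ?thesis
              using f by (simp add: J_def restr_scalar bipoly.span_scale flip: scalar_def)
          next
            case False
            \<comment> \<open>A nonconstant factor pushes the total degree beyond
              \<open>a + b\<close>, so the projection is zero.\<close>
            have "lookup m 0 + lookup m 1 + lookup m 2 + lookup m 3 > 0"
              using False monomial_eqI[of m 0] by auto
            then have "single m c * f \<in> mon_span (?T - bimon a b)"
              using f by (intro mon_span_mult[of _ "{m}" _ ?T])
                (auto simp: J_def mon_span_single lookup_add bimon_def)
            then have "restr (bimon a b) (single m c * f) = 0"
              by (rule restr_eq_0) auto
            then show ?thesis
              by (simp add: bipoly.span_zero)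
          qed
        qed
        moreover have "r * f \<in> mon_span ?T"
          using T f by (simp add: ideal_type_algebra_iff J_def)
        ultimately show ?thesis
          by (simp add: J_def)
      qed
    qed
    moreover have "G \<subseteq> J"
    proof
      fix g assume g: "g \<in> G"
      then obtain a' b' where ab: "g \<in> bihom a' b'"
        using G unfolding min_bihom_gens_def by blast
      have "restr (bimon a b) g \<in> bipoly.span ?B"
      proof (cases "a' = a \<and> b' = b")
        case True
        then show ?thesis
          using g ab by (auto simp: bihom_eq_mon_span restr_eq_self intro!: bipoly.span_base)
      next
        case False
        then have "restr (bimon a b) g = 0"
          using ab by (intro restr_eq_0[of _ "bimon a' b'"]) (auto simp: bihom_eq_mon_span bimon_def)
        then show ?thesis
          by (simp add: bipoly.span_zero)
      qed
      then show "g \<in> J"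
        using g GI I_T by (auto simp: J_def)
    qed
    ultimately have "I \<subseteq> J"
      using genideal_subset_type_algebra G by (metis min_bihom_gens_def)
    then have span: "I \<inter> bihom a b \<subseteq> bipoly.span ?B"
      by (auto simp: J_def bihom_eq_mon_span restr_eq_self dest!: subsetD)
    \<comment> \<open>A generator dependent on the others of its bidegree could be dropped, against
      minimality.\<close>
    have "bipoly.independent ?B"
      unfolding bipoly.dependent_def
    proof
      assume "\<exists>g\<in>?B. g \<in> bipoly.span (?B - {g})"
      then obtain g where g: "g \<in> ?B" "g \<in> bipoly.span (?B - {g})"
        by blast
      define J' where "J' = Idl\<^bsub>\<R>\<^esub> (G - {g})"
      have J': "ideal J' \<R>" "G - {g} \<subseteq> J'"
        unfolding J'_def by (rule genideal_ideal_type_algebra genideal_superset_type_algebra)+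
      have "bipoly.span (?B - {g}) \<subseteq> J'"
        using J' by (intro bipoly.span_minimal subspace_ideal) auto
      then have "G \<subseteq> J'"
        using g J' by auto
      then have "I \<subseteq> J'"
        using genideal_subset_type_algebra[OF J'(1)] G by (metis min_bihom_gens_def)
      moreover have "J' \<subseteq> I"
        unfolding J'_def using GI by (intro genideal_subset_type_algebra[OF I_ideal]) auto
      ultimately show False
        using G g unfolding min_bihom_gens_def J'_def by blast
    qed
    then show ?thesis
      using span GI by (intro bipoly.dim_unique[symmetric, OF _ _ _ refl]) auto
  qed
  \<comment> \<open>The definite description needs a witness: an inclusion-minimal generating subset
    of the finite set \<open>G0\<close>.\<close>
  have "\<exists>G. min_bihom_gens I G"
  proof -
    let ?\<G> = "{G. G \<subseteq> G0 \<and> Idl\<^bsub>\<R>\<^esub> G = I}"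
    have "finite ?\<G>" "?\<G> \<noteq> {}"
      using assms(1) by (auto simp: I_def)
    from finite_has_minimal[OF this] obtain G
      where G: "G \<in> ?\<G>" "\<forall>G'\<in>?\<G>. G' \<subseteq> G \<longrightarrow> G = G'"
      by blast
    have "Idl\<^bsub>\<R>\<^esub> G' \<noteq> I" if "G' \<subset> G" for G'
      using G that by auto
    moreover have "G \<subseteq> (\<Union>a b. bihom a b)" "Idl\<^bsub>\<R>\<^esub> G = I"
      using G(1) assms(2) by auto
    ultimately show ?thesis
      unfolding min_bihom_gens_def by (intro exI[of _ G]) simp
  qed
  then show ?thesis
    unfolding betti0_def using card by (intro the_equality) auto
qed

section \<open>Counting initial generators by monomials\<close>

context coord_change
begin

text \<open>The images of the monomials in \<open>T\<close> form a basis: any combination omitting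
  \<open>m\<close> lies in the image of \<open>mon_span (T - {m})\<close>, which by injectivity
  misses the image of \<open>m\<close>.\<close>

lemma dim_image_mon_span:
  assumes "finite T"
  shows "bipoly.dim (\<phi> ` mon_span T) = card T"
proof -
  let ?e = "\<lambda>m. \<phi> (single m 1)"
  have subspace: "bipoly.subspace (\<phi> ` mon_span A)" for A
    unfolding bipoly.subspace_def
    by (auto simp flip: add scalar_mult intro: mon_span_add mon_span_scalar image_eqI[of _ _ 0])
  have e_inj: "inj_on ?e T"
    by (auto simp: inj_on_def inj dest!: arg_cong[where f = keys])
  have "\<phi> p \<in> bipoly.span (?e ` T)" if "p \<in> mon_span T" for p
  proof -
    have "keys p \<subseteq> T"
      using that by (simp add: mon_span_def)
    then show ?thesis
    proof (induction p rule: keys_induct)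
      case (single m c)
      then have "scalar c * ?e m \<in> bipoly.span (?e ` T)"
        by (intro bipoly.span_scale bipoly.span_base) auto
      then show ?case
        by (simp add: scalar_mult_single flip: scalar_mult)
    qed (auto simp: add bipoly.span_zero bipoly.span_add)
  qed
  moreover have "bipoly.independent (?e ` T)"
    unfolding bipoly.dependent_def
  proof
    assume "\<exists>v\<in>?e ` T. v \<in> bipoly.span (?e ` T - {v})"
    then obtain m where m: "m \<in> T" "?e m \<in> bipoly.span (?e ` T - {?e m})"
      by blast
    have "bipoly.span (?e ` T - {?e m}) \<subseteq> \<phi> ` mon_span (T - {m})"
      by (rule bipoly.span_minimal[OF _ subspace]) (auto intro!: imageI mon_span_single)
    then have "?e m \<in> \<phi> ` mon_span (T - {m})"
      using m(2) by blast
    then show False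
      by (auto simp: inj mon_span_def)
  qed
  ultimately show ?thesis
    using card_image[OF e_inj] by (intro bipoly.dim_unique[of "?e ` T"])
      (auto intro!: imageI mon_span_single)
qed

text \<open>The finite set \<open>F\<close> supplies homogeneous generators. Since
  \<open>a + b\<close> bounds all degrees in \<open>S\<close> from below, the generator count is the
  dimension of the component, which has a monomial basis.\<close>

lemma betti0_image:
  assumes S: "upclosed S"
    and F: "finite F" "F \<subseteq> S" "\<And>m. m \<in> S \<Longrightarrow> \<exists>n\<in>F. \<exists>k. m = k + n"
    and degrees: "\<And>m. m \<in> S \<Longrightarrow> a + b \<le> lookup m 0 + lookup m 1 + lookup m 2 + lookup m 3"
  shows "betti0 (\<phi> ` mon_span S) a b = card (S \<inter> bimon a b)"
proof -
  let ?e = "\<lambda>m. \<phi> (single m 1)"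
  let ?T = "{m. a + b \<le> lookup m 0 + lookup m 1 + lookup m 2 + lookup m 3}"
  have I: "\<phi> ` mon_span S = Idl\<^bsub>\<R>\<^esub> (?e ` F)"
  proof
    show "\<phi> ` mon_span S \<subseteq> Idl\<^bsub>\<R>\<^esub> (?e ` F)"
    proof (rule image_mon_span_subset[OF genideal_ideal_type_algebra])
      fix m assume "m \<in> S"
      then obtain n k where nk: "n \<in> F" "m = k + n"
        using F by blast
      then have "?e n \<in> Idl\<^bsub>\<R>\<^esub> (?e ` F)"
        by (intro subsetD[OF genideal_superset_type_algebra] imageI)
      then have "?e k * ?e n \<in> Idl\<^bsub>\<R>\<^esub> (?e ` F)"
        using genideal_ideal_type_algebra[of "?e ` F"] by (simp add: ideal_type_algebra_iff)
      then show "?e m \<in> Idl\<^bsub>\<R>\<^esub> (?e ` F)"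
        by (simp add: nk mult_single flip: mult)
    qed
    show "Idl\<^bsub>\<R>\<^esub> (?e ` F) \<subseteq> \<phi> ` mon_span S"
      using F by (intro genideal_subset_type_algebra ideal_image_mon_span S)
        (auto intro!: imageI mon_span_single)
  qed
  have e_bihom: "?e m \<in> bihom (lookup m 0 + lookup m 1) (lookup m 2 + lookup m 3)" for m
    unfolding bihom_eq_image by (intro imageI mon_span_single) (simp add: bimon_def)
  \<comment> \<open>The coordinate change mixes monomials only within a bidegree, so the bound on
    the total degree survives.\<close>
  have "?e m \<in> mon_span ?T" if "m \<in> F" for m
  proof -
    have "a + b \<le> lookup m 0 + lookup m 1 + lookup m 2 + lookup m 3"
      using that F degrees by blast
    then show ?thesis
      using e_bihom[of m] by (fastforce simp: bihom_def mon_span_def)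
  qed
  then have "betti0 (\<phi> ` mon_span S) a b = bipoly.dim (\<phi> ` mon_span S \<inter> bihom a b)"
    unfolding I using F(1) e_bihom by (intro betti0_initial) auto
  also have "\<phi> ` mon_span S \<inter> bihom a b = \<phi> ` mon_span (S \<inter> bimon a b)"
    unfolding bihom_eq_image by (rule image_mon_span_Int)
  finally show ?thesis
    by (simp add: dim_image_mon_span)
qed

end

section \<open>Counting monomials\<close>

text \<open>In the new coordinates the points have the ideals \<open>(x\<^sub>0, x\<^sub>2)\<close>,
  \<open>(x\<^sub>0, x\<^sub>3)\<close> and \<open>(x\<^sub>1, x\<^sub>2)\<close>; each inequality
  is membership in the corresponding power.\<close>

definition fat_mons :: "nat \<Rightarrow> nat \<Rightarrow> nat \<Rightarrow> (4 \<Rightarrow>\<^sub>0 nat) set"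
  where "fat_mons m11 m12 m21 = {m. m11 \<le> lookup m 0 + lookup m 2
    \<and> m12 \<le> lookup m 0 + lookup m 3 \<and> m21 \<le> lookup m 1 + lookup m 2}"

lemma upclosed_fat_mons: "upclosed (fat_mons m11 m12 m21)"
  by (auto simp: upclosed_def fat_mons_def lookup_add)

text \<open>Capping all exponents at a number no smaller than any multiplicity preserves the three
  inequalities. Thus finitely many monomials generate the ideal.\<close>

lemma fat_mons_truncate:
  assumes "m \<in> fat_mons m11 m12 m21"
  shows "\<exists>n \<in> {n \<in> fat_mons m11 m12 m21. \<forall>i. lookup n i \<le> m11 + m12 + m21}. \<exists>k. m = k + n"
proof -
  define n where "n = Poly_Mapping.map (min (m11 + m12 + m21)) m"
  have lookup_n: "lookup n i = min (m11 + m12 + m21) (lookup m i)" for i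
    by (simp add: n_def Poly_Mapping.map.rep_eq when_def)
  have "m = (m - n) + n"
    by (rule poly_mapping_eqI) (simp add: lookup_add lookup_minus lookup_n)
  moreover have "n \<in> fat_mons m11 m12 m21" "\<forall>i. lookup n i \<le> m11 + m12 + m21"
    using assms by (auto simp: fat_mons_def lookup_n)
  ultimately show ?thesis
    by blast
qed

text \<open>Multiplication by the variable \<open>i\<close> embeds \<open>N\<close> into
  \<open>M\<close>, and \<open>C\<close> is the complement of the image. The case of exponent 0 is
  listed separately because \<open>m - single i 1\<close> then truncates to
  \<open>m\<close>.\<close>

lemma card_shift:
  fixes M N C :: "(4 \<Rightarrow>\<^sub>0 nat) set"
  assumes "finite M" "\<And>m. m \<in> N \<Longrightarrow> m + single i 1 \<in> M"
    and C: "\<And>m. m \<in> C \<longleftrightarrow> m \<in> M \<and> (lookup m i = 0 \<or> m - single i 1 \<notin> N)"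
  shows "card M = card N + card C"
proof -
  let ?s = "\<lambda>m. m + single i (1::nat)"
  have eq: "m = ?s (m - single i 1)" if "lookup m i \<noteq> 0" for m
    using that by (intro poly_mapping_eqI) (auto simp: lookup_add lookup_minus lookup_single when_def)
  have "M = ?s ` N \<union> C"
  proof (intro equalityI subsetI)
    fix m assume "m \<in> M"
    then show "m \<in> ?s ` N \<union> C"
      using C[of m] eq[of m] by blast
  qed (use assms in auto)
  moreover have "?s ` N \<inter> C = {}"
    by (auto simp: C lookup_add)
  moreover have "finite (?s ` N)" "finite C"
    using assms(1) calculation(1) by auto
  ultimately have "card M = card (?s ` N) + card C"
    by (simp add: card_Un_disjoint)
  also have "card (?s ` N) = card N"
    by (rule card_image) (simp add: inj_on_def)
  finally show ?thesis .
qed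

text \<open>
  \<open>edge\<close> consists of the monomials of the ideal that do not come from bidegree \<open>(a - 1, b)\<close> by
  multiplication with \<open>x\<^sub>1\<close>, and \<open>corner\<close> of those members of \<open>edge\<close> that do not come from
  bidegree \<open>(a, b - 1)\<close> by multiplication with \<open>x\<^sub>3\<close>.
\<close>

definition edge :: "nat \<Rightarrow> nat \<Rightarrow> nat \<Rightarrow> nat \<Rightarrow> nat \<Rightarrow> (4 \<Rightarrow>\<^sub>0 nat) set"
  where "edge m11 m12 m21 a b = {m \<in> fat_mons m11 m12 m21 \<inter> bimon a b.
    lookup m 1 = 0 \<or> lookup m 1 + lookup m 2 = m21}"

definition corner :: "nat \<Rightarrow> nat \<Rightarrow> nat \<Rightarrow> nat \<Rightarrow> nat \<Rightarrow> (4 \<Rightarrow>\<^sub>0 nat) set"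
  where "corner m11 m12 m21 a b = {m \<in> edge m11 m12 m21 a b.
    lookup m 3 = 0 \<or> lookup m 0 + lookup m 3 = m12}"

text \<open>Only the bound by \<open>m21\<close> involves \<open>x\<^sub>1\<close>, so division by
  \<open>x\<^sub>1\<close> leaves the ideal exactly when that bound is attained.\<close>

lemma card_fat_mons_Suc:
  "card (fat_mons m11 m12 m21 \<inter> bimon (Suc a) b)
    = card (fat_mons m11 m12 m21 \<inter> bimon a b) + card (edge m11 m12 m21 (Suc a) b)"
proof (rule card_shift[of _ _ 1])
  show "finite (fat_mons m11 m12 m21 \<inter> bimon (Suc a) b)"
    by simp
next
  fix m
  show "m \<in> edge m11 m12 m21 (Suc a) b \<longleftrightarrow> m \<in> fat_mons m11 m12 m21 \<inter> bimon (Suc a) b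
      \<and> (lookup m 1 = 0 \<or> m - single 1 1 \<notin> fat_mons m11 m12 m21 \<inter> bimon a b)"
    by (auto simp: edge_def fat_mons_def bimon_def lookup_minus lookup_single)
qed (auto simp: fat_mons_def bimon_def lookup_add lookup_single)

lemma fat_mons_0_eq_edge:
  "fat_mons m11 m12 m21 \<inter> bimon 0 b = edge m11 m12 m21 0 b"
  by (auto simp: edge_def bimon_def)

text \<open>The condition defining \<open>edge\<close> does not involve \<open>x\<^sub>3\<close>, so
  division by \<open>x\<^sub>3\<close> can fail only at the bound by \<open>m12\<close>.\<close>

lemma card_edge_Suc:
  "card (edge m11 m12 m21 a (Suc b)) = card (edge m11 m12 m21 a b) + card (corner m11 m12 m21 a (Suc b))"
proof (rule card_shift[of _ _ 3])
  show "finite (edge m11 m12 m21 a (Suc b))"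
    by (simp add: edge_def)
next
  fix m
  show "m \<in> corner m11 m12 m21 a (Suc b) \<longleftrightarrow> m \<in> edge m11 m12 m21 a (Suc b)
      \<and> (lookup m 3 = 0 \<or> m - single 3 1 \<notin> edge m11 m12 m21 a b)"
    by (auto simp: corner_def edge_def fat_mons_def bimon_def lookup_minus lookup_single)
qed (auto simp: edge_def fat_mons_def bimon_def lookup_add lookup_single)

lemma edge_0_eq_corner: "edge m11 m12 m21 a 0 = corner m11 m12 m21 a 0"
  by (auto simp: edge_def corner_def bimon_def)

text \<open>The sum of the bounds by \<open>m12\<close> and \<open>m21\<close> bounds the total
  degree from below.\<close>

lemma corner_below: "a + b < m12 + m21 \<Longrightarrow> corner m11 m12 m21 a b = {}"
  by (auto simp: corner_def edge_def fat_mons_def bimon_def)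

text \<open>In this total degree both bounds, whose sum is the degree, must be equalities, so every
  monomial of the ideal is a corner.\<close>

lemma corner_critical:
  "a + b = m12 + m21 \<Longrightarrow> corner m11 m12 m21 a b = fat_mons m11 m12 m21 \<inter> bimon a b"
  by (auto simp: corner_def edge_def fat_mons_def bimon_def)

text \<open>The bounds by \<open>m12\<close> and \<open>m21\<close> cannot both be attained, so
  \<open>x\<^sub>1\<close> or \<open>x\<^sub>3\<close> is absent, and the corner conditions
  determine the other exponents. For the resulting monomial the exponents of
  \<open>x\<^sub>0\<close> and \<open>x\<^sub>2\<close> sum to at least \<open>m21\<close>, which
  secures the bound by \<open>m11\<close>.\<close>

lemma card_corner_above:
  assumes "m21 \<le> m12" "m11 \<le> m21" "m12 + m21 < a + b"
  shows "card (corner m11 m12 m21 a b) = 1"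
proof -
  \<comment> \<open>Truncated subtraction merges the cases: \<open>j\<close> is positive only if
    \<open>b < m21\<close>, \<open>l\<close> only if \<open>a < m12\<close>, and the degree
    assumption excludes both at once.\<close>
  define j where "j = m21 - b"
  define l where "l = m12 - a"
  obtain n :: "4 \<Rightarrow>\<^sub>0 nat" where n: "lookup n 0 = a - j" "lookup n 1 = j"
    "lookup n 2 = b - l" "lookup n 3 = l"
    by (rule monomial4)
  have "corner m11 m12 m21 a b = {n}"
  proof (intro equalityI subsetI)
    fix m assume "m \<in> corner m11 m12 m21 a b"
    then have "lookup m 1 = j \<and> lookup m 3 = l \<and> lookup m 0 = a - j \<and> lookup m 2 = b - l"
      using assms by (auto simp: corner_def edge_def fat_mons_def bimon_def j_def l_def)
    then have "m = n"
      by (intro monomial_eqI) (simp_all add: n)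
    then show "m \<in> {n}"
      by simp
  next
    fix m assume "m \<in> {n}"
    then show "m \<in> corner m11 m12 m21 a b"
      using assms by (auto simp: corner_def edge_def fat_mons_def bimon_def j_def l_def n)
  qed
  then show ?thesis
    by simp
qed

theorem proposition5p3:
  fixes H1 H2 V1 V2 :: "('k::field_char_0) bipoly"
    and m11 m12 m21 :: nat
  assumes "H1 \<in> bihom 1 0" and "H2 \<in> bihom 1 0" and "H1 \<noteq> 0" and "H2 \<noteq> 0"
    and "\<not> proportional H1 H2"
    and "V1 \<in> bihom 0 1" and "V2 \<in> bihom 0 1" and "V1 \<noteq> 0" and "V2 \<noteq> 0"
    and "\<not> proportional V1 V2"
    and "m21 \<le> m12"
    and "m11 \<le> m21"
  shows "\<forall>a b :: nat.
    delta_hilbert_fun (fat_points_ideal H1 H2 V1 V2 m11 m12 m21) (int a) (int b) =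
      (if a + b < m12 + m21 then 1
       else if a + b = m12 + m21
         then 1 - int (betti0 (fat_points_ideal H1 H2 V1 V2 m11 m12 m21) a b)
       else 0)"
proof (intro allI)
  fix a b :: nat
  obtain \<phi> where \<phi>: "coord_change \<phi>" and forms:
    "\<phi> (xvar 0) = H1" "\<phi> (xvar 1) = H2" "\<phi> (xvar 2) = V1" "\<phi> (xvar 3) = V2"
    using assms coord_change_exists[of H1 H2 V1 V2] by metis
  interpret coord_change \<phi>
    by (rule \<phi>)
  let ?S = "fat_mons m11 m12 m21" and ?I = "fat_points_ideal H1 H2 V1 V2 m11 m12 m21"
  let ?C = "corner m11 m12 m21 a b"
  have I: "?I = \<phi> ` mon_span ?S"
    unfolding fat_points_ideal_def forms[symmetric]
    by (simp only: point_ideal_power distinct_4 not_False_eq_True image_mon_span_Int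
        fat_mons_def Collect_conj_eq Int_assoc)
  have hilbert: "hilbert_fun ?I (int a) (int b) = int (Suc a * Suc b) - int (card (?S \<inter> bimon a b))" for a b
  proof -
    have "card (bimon a b - ?S) = Suc a * Suc b - card (?S \<inter> bimon a b)"
      by (metis Diff_Int_distrib2 Int_absorb Int_commute card_Diff_subset_Int card_bimon finite_Int finite_bimon)
    moreover have "card (?S \<inter> bimon a b) \<le> card (bimon a b)"
      by (intro card_mono) auto
    ultimately show ?thesis
      unfolding I hilbert_fun_image[OF upclosed_fat_mons] by (simp add: card_bimon of_nat_diff)
  qed
  have hilbert_neg: "hilbert_fun ?I a b = 0" if "a < 0 \<or> b < 0" for a b
    using that by (simp add: hilbert_fun_def)
  \<comment> \<open>The mixed difference of \<open>(a + 1) * (b + 1)\<close> is 1, and that of the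
    number of ideal monomials is the corner count. On the boundary the terms with a negative
    argument are 0.\<close>
  have "delta_hilbert_fun ?I (int a) (int b) = 1 - int (card ?C)"
  proof (cases a)
    case a: 0
    show ?thesis
    proof (cases b)
      case 0
      then show ?thesis
        unfolding delta_hilbert_fun_def hilbert
        by (simp add: a hilbert_neg fat_mons_0_eq_edge edge_0_eq_corner)
    next
      case (Suc b')
      then have b: "int b - 1 = int b'"
        by simp
      show ?thesis
        unfolding delta_hilbert_fun_def hilbert b
        by (simp add: a Suc hilbert_neg fat_mons_0_eq_edge card_edge_Suc)
    qed
  next
    case (Suc a')
    then have a: "int a - 1 = int a'"
      by simp
    show ?thesis
    proof (cases b)
      case 0
      then show ?thesis
        unfolding delta_hilbert_fun_def hilbert a
        by (simp add: Suc hilbert_neg card_fat_mons_Suc edge_0_eq_corner)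
    next
      case (Suc b')
      then have b: "int b - 1 = int b'"
        by simp
      show ?thesis
        unfolding delta_hilbert_fun_def a b hilbert
        by (simp add: Suc \<open>a = Suc a'\<close> card_fat_mons_Suc card_edge_Suc)
    qed
  qed
  \<comment> \<open>This is the least total degree allowed by the bounds, so the generators are
    counted by all ideal monomials of the bidegree, which are the corners.\<close>
  moreover have "betti0 ?I a b = card ?C" if "a + b = m12 + m21"
    unfolding I corner_critical[OF that]
  proof (rule betti0_image[OF upclosed_fat_mons])
    show "finite {n \<in> ?S. \<forall>i. lookup n i \<le> m11 + m12 + m21}"
      using finite_bounded_monomials by (rule rev_finite_subset) auto
    show "a + b \<le> lookup m 0 + lookup m 1 + lookup m 2 + lookup m 3" if "m \<in> ?S" for m
      using that \<open>a + b = m12 + m21\<close> by (auto simp: fat_mons_def)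
  qed (use fat_mons_truncate in auto)
  moreover have "card ?C = 1" if "m12 + m21 < a + b"
    using assms that by (intro card_corner_above)
  ultimately show "delta_hilbert_fun ?I (int a) (int b) = (if a + b < m12 + m21 then 1
      else if a + b = m12 + m21 then 1 - int (betti0 ?I a b) else 0)"
    by (auto simp: corner_below)
qed

end
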